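(* Suppose the recovery curves $\{\psi_k\}_{k=1}^{K_{\max}}$ admit a common fraction-based recovery envelope: there is a function $H:[0,1]\to[0,1]$ with $H(0)=0$, $H(1)=1$ and $\psi_k(r)\le H(r/k)$ for all $k=1,\dots,K_{\max}$, $r=0,\dots,k$. Suppose $\Lambda(H)\le\Lambda<\infty$ for some $\Lambda\ge 1$. For a nonempty finite evaluated workflow pool $\mathcal M$, let $$V_1=\max\Big\{0,\max_{g\in\mathcal M}\{\bar a_g-\gamma c_g\}\Big\}$$ denote the best net value achievable by a singleton portfolio or the outside option. Then $$V_1\le \mathrm{OPT}_{\psi,\gamma}(\mathcal M)\le U_{\Lambda,\gamma}(\mathcal M):=\max\Big\{0,\max_{1\le k\le K_{\max}}\big[h_\Lambda(A_k)-\gamma C_k\big]\Big\}.$$ In particular, when $\gamma=0$, letting $a^\star=\max_{g\in\mathcal M}\bar a_g$, $$a^\star\le \mathrm{OPT}_{\psi,0}(\mathcal M)\le h_\Lambda(a^\star).$$ The upper bound $\mathrm{OPT}_{\psi,0}(\mathcal M)\le h_\Lambda(a^\star)$ is called the no-cost upper bound: it applies when the recurring workflow running costs are ignored, i.e., when $\gamma=0$. This no-cost upper bound is tight over the class of selectors with odds lift at most $\Lambda$.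
   Context: Setting. There are $n\ge1$ development tasks $i=1,\dots,n$ and workflow types $g$ in a pool $\mathcal M$. Each task-workflow pair has a correctness indicator $a_{ig}\in\{0,1\}$; each workflow has a recurring execution cost $c_g\ge0$; $\gamma\ge0$ is a cost price; $K_{\max}\ge1$ is an integer bounding the number of executions. "Evaluated" means that the indicators $a_{ig}$ and costs $c_g$ are known for all $g\in\mathcal M$. The standalone accuracy of $g$ is $\bar a_g=\frac1n\sum_{i=1}^n a_{ig}$. For $k\le K_{\max}$ put $A_k=\max_{g\in\mathcal M}\bar a_g$ and $C_k=k\min_{g\in\mathcal M}c_g$. For an execution-count vector $\boldsymbol m\in\mathbb Z_+^{\mathcal M}$ put $k(\boldsymbol m)=\sum_g m_g$, $r_i(\boldsymbol m)=\sum_g a_{ig}m_g$, $C(\boldsymbol m)=\sum_g c_gm_g$. A selector is summarized by recovery curves $\psi_k:\{0,1,\dots,k\}\to[0,1]$, $k=1,\dots,K_{\max}$, with $\psi_k(0)=0$ and $\psi_k(k)=1$; $\psi_k(r)$ is the probability that the selector returns a correct output when $r$ of $k$ candidates are correct. For $\boldsymbol m\ne\boldsymbol 0$ with $k(\boldsymbol m)\le K_{\max}$, $J_\psi(\boldsymbol m)=\frac1n\sum_{i=1}^n\psi_{k(\boldsymbol m)}(r_i(\boldsymbol m))$ and $\Pi_{\psi,\gamma}(\boldsymbol m)=J_\psi(\boldsymbol m)-\gamma C(\boldsymbol m)$; for the zero vector (the outside option of not deploying), $J_\psi(\boldsymbol 0)=\Pi_{\psi,\gamma}(\boldsymbol 0)=0$.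 A singleton portfolio consists of one execution of one workflow. Define $\mathrm{OPT}_{\psi,\gamma}(\mathcal M)=\max\{\Pi_{\psi,\gamma}(\boldsymbol m):\boldsymbol m\in\mathbb Z_+^{\mathcal M},\ k(\boldsymbol m)\le K_{\max}\}$. Odds-lift index of an envelope $H$: $\Lambda(H)=\sup_{p\in(0,1)}\dfrac{H(p)/(1-H(p))}{p/(1-p)}$, with $\Lambda(H)=+\infty$ if $H(p)=1$ for some $p\in(0,1)$. A selector has odds lift at most $\Lambda$ if its recovery curves admit a common fraction-based recovery envelope $H$ (as in the claim) with $\Lambda(H)\le\Lambda$. Notation: $h_\Lambda(p)=\dfrac{\Lambda p}{1+(\Lambda-1)p}$ for $p\in[0,1]$. *)

theory Defs
  imports Complex_Main "HOL-Library.Extended_Real"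
begin

text \<open>
  Tasks are the naturals \<open>1..n\<close>; workflows are elements of a set \<open>M\<close> of arbitrary type.
  The indicator \<open>a i g\<close> is a natural number, so that the number of correct candidates can be used
  directly as the argument of a recovery curve \<open>\<psi> k :: nat \<Rightarrow> real\<close>, of which only the values on
  \<open>{0..k}\<close> matter.
\<close>

definition evaluated_pool ::
  "nat \<Rightarrow> (nat \<Rightarrow> 'w \<Rightarrow> nat) \<Rightarrow> ('w \<Rightarrow> real) \<Rightarrow> 'w set \<Rightarrow> bool" where
  "evaluated_pool n a c M \<longleftrightarrow>
     1 \<le> n \<and> finite M \<and> M \<noteq> {} \<and>
     (\<forall>i\<in>{1..n}. \<forall>g\<in>M. a i g \<in> {0, 1}) \<and> (\<forall>g\<in>M. 0 \<le> c g)"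

definition accuracy :: "nat \<Rightarrow> (nat \<Rightarrow> 'w \<Rightarrow> nat) \<Rightarrow> 'w \<Rightarrow> real" where
  "accuracy n a g = (\<Sum>i=1..n. real (a i g)) / real n"

text \<open>This is \<open>a\<^sup>\<star>\<close>, and also \<open>A\<^sub>k\<close>, which does not depend on \<open>k\<close>.\<close>

definition best_accuracy :: "nat \<Rightarrow> (nat \<Rightarrow> 'w \<Rightarrow> nat) \<Rightarrow> 'w set \<Rightarrow> real" where
  "best_accuracy n a M = (MAX g\<in>M. accuracy n a g)"

definition min_cost :: "('w \<Rightarrow> real) \<Rightarrow> 'w set \<Rightarrow> nat \<Rightarrow> real" where
  "min_cost c M k = real k * (MIN g\<in>M. c g)"

definition recovery_curves :: "nat \<Rightarrow> (nat \<Rightarrow> nat \<Rightarrow> real) \<Rightarrow> bool" where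
  "recovery_curves K \<psi> \<longleftrightarrow>
     (\<forall>k\<in>{1..K}. \<psi> k 0 = 0 \<and> \<psi> k k = 1 \<and> (\<forall>r\<in>{0..k}. \<psi> k r \<in> {0..1}))"

definition executions :: "'w set \<Rightarrow> ('w \<Rightarrow> nat) \<Rightarrow> nat" where
  "executions M m = (\<Sum>g\<in>M. m g)"

definition num_correct :: "(nat \<Rightarrow> 'w \<Rightarrow> nat) \<Rightarrow> 'w set \<Rightarrow> ('w \<Rightarrow> nat) \<Rightarrow> nat \<Rightarrow> nat" where
  "num_correct a M m i = (\<Sum>g\<in>M. a i g * m g)"

definition cost :: "('w \<Rightarrow> real) \<Rightarrow> 'w set \<Rightarrow> ('w \<Rightarrow> nat) \<Rightarrow> real" where
  "cost c M m = (\<Sum>g\<in>M. c g * real (m g))"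

text \<open>Vectors indexed by \<open>M\<close> are functions that vanish outside \<open>M\<close>.\<close>

definition portfolios :: "'w set \<Rightarrow> nat \<Rightarrow> ('w \<Rightarrow> nat) set" where
  "portfolios M K = {m. (\<forall>g. g \<notin> M \<longrightarrow> m g = 0) \<and> executions M m \<le> K}"

definition J_acc ::
  "(nat \<Rightarrow> nat \<Rightarrow> real) \<Rightarrow> nat \<Rightarrow> (nat \<Rightarrow> 'w \<Rightarrow> nat) \<Rightarrow> 'w set \<Rightarrow> ('w \<Rightarrow> nat) \<Rightarrow> real" where
  "J_acc \<psi> n a M m =
     (if m = (\<lambda>_. 0) then 0
      else (\<Sum>i=1..n. \<psi> (executions M m) (num_correct a M m i)) / real n)"

text \<open>At the zero vector this is \<open>0\<close>, because both terms are.\<close>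

definition net_value ::
  "(nat \<Rightarrow> nat \<Rightarrow> real) \<Rightarrow> real \<Rightarrow> nat \<Rightarrow> (nat \<Rightarrow> 'w \<Rightarrow> nat) \<Rightarrow> ('w \<Rightarrow> real) \<Rightarrow> 'w set
     \<Rightarrow> ('w \<Rightarrow> nat) \<Rightarrow> real" where
  "net_value \<psi> \<gamma> n a c M m = J_acc \<psi> n a M m - \<gamma> * cost c M m"

definition OPT ::
  "(nat \<Rightarrow> nat \<Rightarrow> real) \<Rightarrow> real \<Rightarrow> nat \<Rightarrow> nat \<Rightarrow> (nat \<Rightarrow> 'w \<Rightarrow> nat) \<Rightarrow> ('w \<Rightarrow> real) \<Rightarrow> 'w set
     \<Rightarrow> real" where
  "OPT \<psi> \<gamma> K n a c M = (MAX m\<in>portfolios M K. net_value \<psi> \<gamma> n a c M m)"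

text \<open>The maximum defining \<open>OPT\<close> ranges over a finite nonempty set.\<close>

lemma finite_portfolios:
  assumes "finite M"
  shows "finite (portfolios M K)"
proof (rule finite_subset)
  show "portfolios M K \<subseteq> {m. \<forall>g. (g \<in> M \<longrightarrow> m g \<in> {..K}) \<and> (g \<notin> M \<longrightarrow> m g = 0)}"
  proof
    fix m assume m: "m \<in> portfolios M K"
    have "m g \<le> K" if "g \<in> M" for g
    proof -
      have "m g \<le> sum m M"
        using assms that by (intro member_le_sum) simp_all
      also have "\<dots> \<le> K"
        using m by (simp add: portfolios_def executions_def)
      finally show ?thesis .
    qed
    with m show "m \<in> {m. \<forall>g. (g \<in> M \<longrightarrow> m g \<in> {..K}) \<and> (g \<notin> M \<longrightarrow> m g = 0)}"
      by (simp add: portfolios_def)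
  qed
  show "finite {m. \<forall>g. (g \<in> M \<longrightarrow> m g \<in> {..K}) \<and> (g \<notin> M \<longrightarrow> m g = (0::nat))}"
    by (rule finite_set_of_finite_funs[OF assms finite_atMost])
qed

lemma zero_in_portfolios: "(\<lambda>_. 0) \<in> portfolios M K"
  by (simp add: portfolios_def executions_def)

definition V1 :: "real \<Rightarrow> nat \<Rightarrow> (nat \<Rightarrow> 'w \<Rightarrow> nat) \<Rightarrow> ('w \<Rightarrow> real) \<Rightarrow> 'w set \<Rightarrow> real" where
  "V1 \<gamma> n a c M = max 0 (MAX g\<in>M. accuracy n a g - \<gamma> * c g)"

definition recovery_envelope ::
  "nat \<Rightarrow> (nat \<Rightarrow> nat \<Rightarrow> real) \<Rightarrow> (real \<Rightarrow> real) \<Rightarrow> bool" where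
  "recovery_envelope K \<psi> H \<longleftrightarrow>
     (\<forall>p\<in>{0..1}. H p \<in> {0..1}) \<and> H 0 = 0 \<and> H 1 = 1 \<and>
     (\<forall>k\<in>{1..K}. \<forall>r\<in>{0..k}. \<psi> k r \<le> H (real r / real k))"

definition odds_lift :: "(real \<Rightarrow> real) \<Rightarrow> ereal" where
  "odds_lift H =
     (if \<exists>p\<in>{0<..<1}. H p = 1 then \<infinity>
      else (SUP p\<in>{0<..<1}. ereal ((H p / (1 - H p)) / (p / (1 - p)))))"

definition odds_lift_at_most :: "nat \<Rightarrow> (nat \<Rightarrow> nat \<Rightarrow> real) \<Rightarrow> real \<Rightarrow> bool" where
  "odds_lift_at_most K \<psi> \<Lambda> \<longleftrightarrow> (\<exists>H. recovery_envelope K \<psi> H \<and> odds_lift H \<le> ereal \<Lambda>)"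

definition h_lift :: "real \<Rightarrow> real \<Rightarrow> real" where
  "h_lift \<Lambda> p = \<Lambda> * p / (1 + (\<Lambda> - 1) * p)"

definition U_bound ::
  "real \<Rightarrow> real \<Rightarrow> nat \<Rightarrow> nat \<Rightarrow> (nat \<Rightarrow> 'w \<Rightarrow> nat) \<Rightarrow> ('w \<Rightarrow> real) \<Rightarrow> 'w set \<Rightarrow> real" where
  "U_bound \<Lambda> \<gamma> K n a c M =
     max 0 (MAX k\<in>{1..K}. h_lift \<Lambda> (best_accuracy n a M) - \<gamma> * min_cost c M k)"

text \<open>
  Tightness of the bound \<open>OPT \<le> h_lift \<Lambda> a\<^sup>\<star>\<close> at \<open>\<gamma> = 0\<close>: for each value \<open>x\<close> that \<open>a\<^sup>\<star>\<close> can take, some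
  selector of odds lift at most \<open>\<Lambda>\<close> attains the bound on some pool with \<open>a\<^sup>\<star> = x\<close>. The possible
  values are the rationals in \<open>[0, 1]\<close>, since an accuracy is a fraction with denominator \<open>n\<close>. The
  execution bound \<open>K\<close> belongs to the instance: for \<open>K = 1\<close> every selector gives \<open>OPT = a\<^sup>\<star>\<close>.
\<close>

definition no_cost_bound_tight :: "real \<Rightarrow> bool" where
  "no_cost_bound_tight \<Lambda> \<longleftrightarrow>
     (\<forall>x \<in> \<rat> \<inter> {0..1}. \<exists>n K (M :: nat set) a c \<psi>.
        1 \<le> K \<and> evaluated_pool n a c M \<and>
        recovery_curves K \<psi> \<and> odds_lift_at_most K \<psi> \<Lambda> \<and>
        best_accuracy n a M = x \<and> OPT \<psi> 0 K n a c M = h_lift \<Lambda> x)"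

end

theory Submission
  imports Defs
begin

text \<open>
  An odds lift of at most \<open>\<Lambda>\<close> means \<open>H \<le> h\<^sub>\<Lambda>\<close> on \<open>[0, 1]\<close>, and \<open>h\<^sub>\<Lambda>\<close> is increasing and concave. The
  recovery fractions \<open>r\<^sub>i / k\<close> of a portfolio have a mean over the tasks that is a weighted average of
  standalone accuracies, hence at most \<open>a\<^sup>\<star>\<close>, so Jensen's inequality (used in the form of the tangent
  line at \<open>a\<^sup>\<star>\<close>) gives \<open>J \<le> h\<^sub>\<Lambda> a\<^sup>\<star>\<close>. Equality holds when every task has recovery fraction \<open>a\<^sup>\<star>\<close>:
  for \<open>x = p / q\<close> this is achieved by a cyclic design of \<open>q\<close> tasks and \<open>q\<close> workflows, each executed
  once, with the selector \<open>\<psi>\<^sub>k r = h\<^sub>\<Lambda> (r / k)\<close>.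
\<close>

section \<open>The curve \<open>h_lift\<close>: range, concavity and extremality among
  envelopes\<close>

lemma h_lift_denom_pos:
  assumes "1 \<le> \<Lambda>" "0 \<le> p"
  shows "0 < 1 + (\<Lambda> - 1) * (p::real)"
  using assms by (intro add_pos_nonneg) auto

lemma h_lift_0 [simp]: "h_lift \<Lambda> 0 = 0"
  by (simp add: h_lift_def)

lemma h_lift_1: "\<Lambda> \<noteq> 0 \<Longrightarrow> h_lift \<Lambda> 1 = 1"
  by (simp add: h_lift_def)

lemma h_lift_nonneg:
  assumes "1 \<le> \<Lambda>" "0 \<le> p"
  shows "0 \<le> h_lift \<Lambda> p"
  using h_lift_denom_pos[OF assms] assms by (simp add: h_lift_def)

lemma one_minus_h_lift:
  assumes "1 \<le> \<Lambda>" "0 \<le> p"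
  shows "1 - h_lift \<Lambda> p = (1 - p) / (1 + (\<Lambda> - 1) * p)"
  using h_lift_denom_pos[OF assms] by (simp add: h_lift_def field_simps)

lemma h_lift_le_1:
  assumes "1 \<le> \<Lambda>" "0 \<le> p" "p \<le> 1"
  shows "h_lift \<Lambda> p \<le> 1"
proof -
  have "0 \<le> 1 - h_lift \<Lambda> p"
    using h_lift_denom_pos[OF assms(1,2)] assms by (simp add: one_minus_h_lift)
  then show ?thesis by simp
qed

text \<open>Concavity without calculus: the factor of \<open>p - q\<close> is the derivative of
  \<open>h_lift \<Lambda>\<close> at \<open>q\<close>, and the gap between tangent and curve is an
  explicit multiple of \<open>(p - q)\<^sup>2\<close>, nonnegative because
  \<open>1 \<le> \<Lambda>\<close>.\<close>

lemma h_lift_le_tangent: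
  assumes "1 \<le> \<Lambda>" "0 \<le> p" "0 \<le> q"
  shows "h_lift \<Lambda> p \<le> h_lift \<Lambda> q + \<Lambda> / (1 + (\<Lambda> - 1) * q)\<^sup>2 * (p - q)"
proof -
  define P where "P = 1 + (\<Lambda> - 1) * p"
  define Q where "Q = 1 + (\<Lambda> - 1) * q"
  have pos: "0 < P" "0 < Q"
    using h_lift_denom_pos assms by (auto simp: P_def Q_def)
  have "h_lift \<Lambda> q + \<Lambda> / Q\<^sup>2 * (p - q) - h_lift \<Lambda> p
      = (\<Lambda> * q * Q * P + \<Lambda> * (p - q) * P - \<Lambda> * p * Q\<^sup>2) / (Q\<^sup>2 * P)"
    using pos unfolding h_lift_def P_def[symmetric] Q_def[symmetric]
    by (simp add: field_simps power2_eq_square)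
  also have "\<Lambda> * q * Q * P + \<Lambda> * (p - q) * P - \<Lambda> * p * Q\<^sup>2 = \<Lambda> * (\<Lambda> - 1) * (p - q)\<^sup>2"
    unfolding P_def Q_def by (simp add: algebra_simps power2_eq_square)
  finally have "h_lift \<Lambda> q + \<Lambda> / Q\<^sup>2 * (p - q) - h_lift \<Lambda> p
      = \<Lambda> * (\<Lambda> - 1) * (p - q)\<^sup>2 / (Q\<^sup>2 * P)" .
  also have "\<dots> \<ge> 0"
    using pos assms by auto
  finally show ?thesis by (simp add: Q_def)
qed

text \<open>For interior \<open>p\<close>, the bound on the odds ratio is solved for
  \<open>H p\<close>. The supremum does not see the endpoints; there the normalisation of
  \<open>H\<close> decides.\<close>

lemma envelope_le_h_lift:
  assumes env: "recovery_envelope K \<psi> H" and "1 \<le> \<Lambda>"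
    and lift: "odds_lift H \<le> ereal \<Lambda>" and p: "p \<in> {0..1}"
  shows "H p \<le> h_lift \<Lambda> p"
proof -
  consider "p = 0" | "p = 1" | "p \<in> {0<..<1}" using p by fastforce
  then show ?thesis
  proof cases
    case 3
    \<comment> \<open>An interior value 1 would make the odds lift infinite. Excluding it keeps
      \<open>1 - H p\<close> positive, so the denominators can be cleared.\<close>
    have no1: "\<not> (\<exists>p\<in>{0<..<1}. H p = 1)"
      using lift by (auto simp: odds_lift_def split: if_splits)
    have H: "0 \<le> H p" "H p < 1"
      using env p no1 3 by (auto simp: recovery_envelope_def less_le)
    have "ereal ((H p / (1 - H p)) / (p / (1 - p))) \<le> ereal \<Lambda>"
      using lift no1 3 by (auto simp: odds_lift_def SUP_le_iff)
    then have "(H p / (1 - H p)) / (p / (1 - p)) \<le> \<Lambda>" by simp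
    then have "H p / (1 - H p) \<le> \<Lambda> * (p / (1 - p))"
      using 3 by (subst (asm) pos_divide_le_eq) auto
    then have "H p * (1 - p) \<le> \<Lambda> * p * (1 - H p)"
      using 3 H by (simp add: divide_simps mult.commute)
    then have "H p * (1 + (\<Lambda> - 1) * p) \<le> \<Lambda> * p"
      by (simp add: algebra_simps)
    then show ?thesis
      using h_lift_denom_pos[of \<Lambda> p] assms(2) 3 by (simp add: h_lift_def pos_le_divide_eq)
  qed (use env \<open>1 \<le> \<Lambda>\<close> in \<open>auto simp: recovery_envelope_def h_lift_1\<close>)
qed

text \<open>\<open>h_lift \<Lambda>\<close> multiplies the odds of every interior \<open>p\<close>
  by exactly \<open>\<Lambda>\<close>, so it is itself an admissible envelope, the one used for
  tightness.\<close>

lemma odds_lift_h_lift_le: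
  assumes "1 \<le> \<Lambda>"
  shows "odds_lift (h_lift \<Lambda>) \<le> ereal \<Lambda>"
proof -
  have lt: "h_lift \<Lambda> p \<noteq> 1" and odds: "(h_lift \<Lambda> p / (1 - h_lift \<Lambda> p)) / (p / (1 - p)) = \<Lambda>"
    if p: "p \<in> {0<..<1}" for p
  proof -
    have d: "0 < 1 + (\<Lambda> - 1) * p" and p': "0 \<le> p" "p \<noteq> 0" "1 - p \<noteq> 0"
      using h_lift_denom_pos[OF assms] p by auto
    have eq: "1 - h_lift \<Lambda> p = (1 - p) / (1 + (\<Lambda> - 1) * p)"
      using one_minus_h_lift[OF assms p'(1)] .
    with d p' show "h_lift \<Lambda> p \<noteq> 1" by auto
    show "(h_lift \<Lambda> p / (1 - h_lift \<Lambda> p)) / (p / (1 - p)) = \<Lambda>"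
      unfolding eq using d p' by (simp add: h_lift_def)
  qed
  then show ?thesis
    by (auto simp: odds_lift_def SUP_le_iff)
qed

section \<open>Counting correct candidates and bounding the accuracy of a portfolio\<close>

lemma best_accuracy_ge:
  assumes "finite M" "g \<in> M"
  shows "accuracy n a g \<le> best_accuracy n a M"
  using assms by (simp add: best_accuracy_def)

lemma best_accuracy_nonneg:
  assumes "evaluated_pool n a c M"
  shows "0 \<le> best_accuracy n a M"
proof -
  obtain g where "g \<in> M" "finite M" using assms by (auto simp: evaluated_pool_def)
  then have "accuracy n a g \<le> best_accuracy n a M" by (simp add: best_accuracy_ge)
  moreover have "0 \<le> accuracy n a g" by (simp add: accuracy_def sum_nonneg)
  ultimately show ?thesis by simp
qed

lemma executions_pos:
  assumes "finite M" "m \<in> portfolios M K" "m \<noteq> (\<lambda>_. 0)"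
  shows "0 < executions M m"
proof -
  obtain g where "m g \<noteq> 0" using assms(3) by auto
  moreover from this have "g \<in> M" using assms(2) by (auto simp: portfolios_def)
  ultimately show ?thesis
    using assms(1) by (auto simp: executions_def intro!: gr0I)
qed

lemma num_correct_le_executions:
  assumes "evaluated_pool n a c M" "i \<in> {1..n}"
  shows "num_correct a M m i \<le> executions M m"
  unfolding num_correct_def executions_def
  using assms by (intro sum_mono) (auto simp: evaluated_pool_def dest!: bspec)

text \<open>Double counting: summed over the tasks first, each workflow contributes its accuracy
  times \<open>n\<close> times its number of executions.\<close>

lemma sum_num_correct_le:
  assumes "evaluated_pool n a c M"
  shows "(\<Sum>i=1..n. real (num_correct a M m i)) \<le> real n * real (executions M m) * best_accuracy n a M"
proof -
  have n: "0 < real n" and fin: "finite M" using assms by (auto simp: evaluated_pool_def)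
  have "(\<Sum>i=1..n. real (num_correct a M m i)) = (\<Sum>g\<in>M. \<Sum>i=1..n. real (a i g) * real (m g))"
    unfolding num_correct_def by (subst sum.swap) simp
  also have "\<dots> = (\<Sum>g\<in>M. real n * accuracy n a g * real (m g))"
    using n by (simp add: accuracy_def sum_distrib_right)
  also have "\<dots> \<le> (\<Sum>g\<in>M. real n * best_accuracy n a M * real (m g))"
    using fin by (intro sum_mono mult_right_mono mult_left_mono best_accuracy_ge) auto
  also have "\<dots> = real n * real (executions M m) * best_accuracy n a M"
    by (simp add: executions_def sum_distrib_left mult_ac)
  finally show ?thesis .
qed

lemma J_acc_le_h_lift:
  assumes pool: "evaluated_pool n a c M" and env: "recovery_envelope K \<psi> H"
    and "1 \<le> \<Lambda>" and lift: "odds_lift H \<le> ereal \<Lambda>" and m: "m \<in> portfolios M K"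
  shows "J_acc \<psi> n a M m \<le> h_lift \<Lambda> (best_accuracy n a M)"
proof (cases "m = (\<lambda>_. 0)")
  case True
  then show ?thesis
    using h_lift_nonneg[OF \<open>1 \<le> \<Lambda>\<close> best_accuracy_nonneg[OF pool]] by (simp add: J_acc_def)
next
  case False
  define k where "k = executions M m"
  define A where "A = best_accuracy n a M"
  \<comment> \<open>The tangent slope at \<open>A\<close>, common to all tasks, so that summing the
    tangent bounds leaves only the mean recovery fraction.\<close>
  define s where "s = \<Lambda> / (1 + (\<Lambda> - 1) * A)\<^sup>2"
  let ?r = "num_correct a M m"
  have n: "0 < real n" and fin: "finite M" using pool by (auto simp: evaluated_pool_def)
  have k: "0 < k" "k \<in> {1..K}"
    using executions_pos[OF fin m False] m by (auto simp: k_def portfolios_def)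
  have A: "0 \<le> A" using best_accuracy_nonneg[OF pool] by (simp add: A_def)
  have s: "0 \<le> s" using \<open>1 \<le> \<Lambda>\<close> by (simp add: s_def)
  have "\<psi> k (?r i) \<le> h_lift \<Lambda> A + s * (real (?r i) / real k - A)" if "i \<in> {1..n}" for i
  proof -
    have r: "?r i \<le> k" using num_correct_le_executions[OF pool that] by (simp add: k_def)
    then have "\<psi> k (?r i) \<le> H (real (?r i) / real k)"
      using env k(2) by (auto simp: recovery_envelope_def)
    also have "\<dots> \<le> h_lift \<Lambda> (real (?r i) / real k)"
      using r k by (intro envelope_le_h_lift[OF env \<open>1 \<le> \<Lambda>\<close> lift]) auto
    also have "\<dots> \<le> h_lift \<Lambda> A + s * (real (?r i) / real k - A)"
      unfolding s_def using \<open>1 \<le> \<Lambda>\<close> A by (intro h_lift_le_tangent) auto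
    finally show ?thesis .
  qed
  then have "(\<Sum>i=1..n. \<psi> k (?r i)) \<le> (\<Sum>i=1..n. h_lift \<Lambda> A + s * (real (?r i) / real k - A))"
    by (rule sum_mono)
  also have "\<dots> = real n * h_lift \<Lambda> A + s * ((\<Sum>i=1..n. real (?r i)) / real k - real n * A)"
    by (simp add: sum.distrib sum_subtractf flip: sum_distrib_left sum_divide_distrib)
  \<comment> \<open>The mean fraction may lie strictly below \<open>A\<close>; since the slope is
    nonnegative, the linear term can still be dropped.\<close>
  also have "\<dots> \<le> real n * h_lift \<Lambda> A"
  proof -
    have "(\<Sum>i=1..n. real (?r i)) / real k \<le> real n * A"
      using sum_num_correct_le[OF pool, of m] k(1) by (simp add: k_def A_def divide_simps mult_ac)
    then show ?thesis using s by (simp add: mult_nonneg_nonpos)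
  qed
  finally show ?thesis
    using n False by (simp add: J_acc_def k_def A_def divide_simps mult_ac)
qed

section \<open>Lower and upper bounds on the optimum\<close>

lemma net_value_le_OPT:
  assumes "finite M" "m \<in> portfolios M K"
  shows "net_value \<psi> \<gamma> n a c M m \<le> OPT \<psi> \<gamma> K n a c M"
  unfolding OPT_def using assms by (intro Max_ge) (auto intro: finite_portfolios)

lemma OPT_le:
  assumes "finite M" "\<And>m. m \<in> portfolios M K \<Longrightarrow> net_value \<psi> \<gamma> n a c M m \<le> B"
  shows "OPT \<psi> \<gamma> K n a c M \<le> B"
  unfolding OPT_def using assms finite_portfolios zero_in_portfolios[of M K]
  by (subst Max_le_iff) auto

lemma V1_le_OPT:
  assumes pool: "evaluated_pool n a c M" and K: "1 \<le> K" and curves: "recovery_curves K \<psi>"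
  shows "V1 \<gamma> n a c M \<le> OPT \<psi> \<gamma> K n a c M"
proof -
  have fin: "finite M" "M \<noteq> {}" using pool by (auto simp: evaluated_pool_def)
  have "0 \<le> OPT \<psi> \<gamma> K n a c M"
    using net_value_le_OPT[OF fin(1) zero_in_portfolios, of \<psi> \<gamma> n a c K]
    by (simp add: net_value_def J_acc_def cost_def)
  moreover have "accuracy n a g - \<gamma> * c g \<le> OPT \<psi> \<gamma> K n a c M" if g: "g \<in> M" for g
  proof -
    define m where "m = (\<lambda>h. if h = g then 1 else 0 :: nat)"
    have exec: "executions M m = 1" and cost: "cost c M m = c g"
      and corr: "num_correct a M m i = a i g" for i
      using fin g by (simp_all add: executions_def cost_def num_correct_def m_def if_distrib cong: if_cong)
    \<comment> \<open>With one candidate the only counts are 0 and 1, where the normalisation fixes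
      every recovery curve.\<close>
    have "\<psi> 1 (a i g) = real (a i g)" if "i \<in> {1..n}" for i
    proof -
      have "a i g \<in> {0, 1}" using pool g that by (auto simp: evaluated_pool_def)
      then show ?thesis using curves K by (auto simp: recovery_curves_def)
    qed
    moreover have "m \<noteq> (\<lambda>_. 0)" by (auto simp: m_def fun_eq_iff)
    ultimately have "J_acc \<psi> n a M m = accuracy n a g"
      by (simp add: J_acc_def accuracy_def exec corr)
    moreover have "m \<in> portfolios M K"
      using exec K g by (auto simp: portfolios_def m_def)
    ultimately show ?thesis
      using net_value_le_OPT[OF fin(1), of m K \<psi> \<gamma> n a c] by (simp add: net_value_def cost)
  qed
  ultimately show ?thesis using fin by (auto simp: V1_def)
qed

lemma OPT_le_U_bound:
  assumes pool: "evaluated_pool n a c M" and "0 \<le> \<gamma>" and env: "recovery_envelope K \<psi> H"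
    and "1 \<le> \<Lambda>" and lift: "odds_lift H \<le> ereal \<Lambda>"
  shows "OPT \<psi> \<gamma> K n a c M \<le> U_bound \<Lambda> \<gamma> K n a c M"
proof (rule OPT_le)
  show fin: "finite M" using pool by (auto simp: evaluated_pool_def)
  fix m assume m: "m \<in> portfolios M K"
  show "net_value \<psi> \<gamma> n a c M m \<le> U_bound \<Lambda> \<gamma> K n a c M"
  proof (cases "m = (\<lambda>_. 0)")
    case True
    then show ?thesis by (simp add: net_value_def J_acc_def cost_def U_bound_def)
  next
    case False
    define k where "k = executions M m"
    have k: "k \<in> {1..K}"
      using executions_pos[OF fin m False] m by (auto simp: k_def portfolios_def)
    \<comment> \<open>Each of the \<open>k\<close> executions is charged at the cheapest rate; the
      actual \<open>k\<close> then selects one term of the maximum in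
      \<open>U_bound\<close>.\<close>
    have "min_cost c M k = (\<Sum>g\<in>M. (MIN g\<in>M. c g) * real (m g))"
      by (simp add: min_cost_def k_def executions_def sum_distrib_left mult.commute)
    also have "\<dots> \<le> cost c M m"
      unfolding cost_def using fin by (intro sum_mono mult_right_mono) auto
    finally have "\<gamma> * min_cost c M k \<le> \<gamma> * cost c M m"
      using \<open>0 \<le> \<gamma>\<close> by (rule mult_left_mono)
    then have "net_value \<psi> \<gamma> n a c M m \<le> h_lift \<Lambda> (best_accuracy n a M) - \<gamma> * min_cost c M k"
      using J_acc_le_h_lift[OF pool env \<open>1 \<le> \<Lambda>\<close> lift m] by (simp add: net_value_def)
    also have "\<dots> \<le> (MAX k\<in>{1..K}. h_lift \<Lambda> (best_accuracy n a M) - \<gamma> * min_cost c M k)"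
      using k by (intro Max_ge) auto
    finally show ?thesis by (simp add: U_bound_def)
  qed
qed

lemma OPT_no_cost_le:
  assumes pool: "evaluated_pool n a c M" and env: "recovery_envelope K \<psi> H"
    and "1 \<le> \<Lambda>" and lift: "odds_lift H \<le> ereal \<Lambda>"
  shows "OPT \<psi> 0 K n a c M \<le> h_lift \<Lambda> (best_accuracy n a M)"
  using pool J_acc_le_h_lift[OF assms]
  by (intro OPT_le) (auto simp: evaluated_pool_def net_value_def)

section \<open>Tightness by a cyclic design\<close>

lemma sum_cyclic_shift:
  fixes f :: "nat \<Rightarrow> 'b::cancel_comm_monoid_add"
  shows "(\<Sum>j<q. f ((i + j) mod q)) = sum f {..<q}"
proof (induction i)
  case 0
  show ?case by (rule sum.cong) auto
next
  case (Suc i)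
  \<comment> \<open>The sum over \<open>q + 1\<close> consecutive indices is split at either end;
    its first and last terms agree modulo \<open>q\<close> and cancel.\<close>
  have "(\<Sum>j<q. f ((i + j) mod q)) + f ((i + q) mod q) = (\<Sum>j<Suc q. f ((i + j) mod q))"
    by simp
  also have "\<dots> = f (i mod q) + (\<Sum>j<q. f ((Suc i + j) mod q))"
    by (subst sum.lessThan_Suc_shift) simp
  finally show ?case using Suc by (simp add: add.commute)
qed

lemma no_cost_bound_tight:
  assumes "1 \<le> \<Lambda>"
  shows "no_cost_bound_tight \<Lambda>"
  unfolding no_cost_bound_tight_def
proof
  fix x :: real assume "x \<in> \<rat> \<inter> {0..1}"
  then have "x \<in> \<rat>" and x: "0 \<le> x" "x \<le> 1" by auto
  then obtain p q :: nat where q: "q \<noteq> 0" and xpq: "x = real p / real q"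
    using Rats_abs_nat_div_natE[of x] by (metis abs_of_nonneg)
  have pq: "p \<le> q" using x q by (simp add: xpq divide_simps split: if_splits)
  define f :: "nat \<Rightarrow> nat" where "f = (\<lambda>j. if j < p then 1 else 0)"
  \<comment> \<open>A circulant 0-1 matrix: column sums \<open>p\<close> give every workflow
    accuracy \<open>x\<close>, and row sums \<open>p\<close> give every task the same number of
    correct candidates.\<close>
  define a :: "nat \<Rightarrow> nat \<Rightarrow> nat" where "a = (\<lambda>i g. f ((i + g) mod q))"
  define M :: "nat set" where "M = {..<q}"
  define \<psi> where "\<psi> = (\<lambda>k r. h_lift \<Lambda> (real r / real k))"
  define c :: "nat \<Rightarrow> real" where "c = (\<lambda>_. 0)"
  \<comment> \<open>One execution of each workflow uses up the bound \<open>K = q\<close> and gives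
    every task the fraction \<open>p / q = x\<close>, so nothing is lost in Jensen's
    inequality.\<close>
  define m :: "nat \<Rightarrow> nat" where "m = (\<lambda>g. if g < q then 1 else 0)"
  have "{..<q} \<inter> {j. j < p} = {..<p}" using pq by auto
  then have sum_f: "sum f {..<q} = p"
    by (simp add: f_def sum.If_cases)
  have pool: "evaluated_pool q a c M"
    using q by (auto simp: evaluated_pool_def a_def f_def M_def c_def)
  have curves: "recovery_curves q \<psi>"
    using assms h_lift_nonneg[OF assms] h_lift_le_1[OF assms]
    by (auto simp: recovery_curves_def \<psi>_def h_lift_1)
  have env: "recovery_envelope q \<psi> (h_lift \<Lambda>)"
    using assms h_lift_nonneg[OF assms] h_lift_le_1[OF assms]
    by (auto simp: recovery_envelope_def \<psi>_def h_lift_1)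
  have lift: "odds_lift (h_lift \<Lambda>) \<le> ereal \<Lambda>" using odds_lift_h_lift_le[OF assms] .
  have acc: "accuracy q a g = x" for g
  proof -
    \<comment> \<open>Tasks are numbered from 1, hence the shift by \<open>Suc g\<close> instead of
      \<open>g\<close>.\<close>
    have "(\<Sum>i=1..q. a i g) = (\<Sum>i<q. f ((Suc g + i) mod q))"
      by (simp add: a_def sum.atLeast1_atMost_eq add.commute)
    also have "\<dots> = p" by (simp only: sum_cyclic_shift sum_f)
    finally show ?thesis unfolding accuracy_def xpq by (simp flip: of_nat_sum)
  qed
  have best: "best_accuracy q a M = x"
    using q by (simp add: best_accuracy_def acc M_def lessThan_empty_iff)
  have exec: "executions M m = q" by (simp add: executions_def M_def m_def)
  have corr: "num_correct a M m i = p" for i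
    using sum_cyclic_shift[of f i q] by (simp add: num_correct_def M_def m_def a_def sum_f)
  have "finite M" by (simp add: M_def)
  moreover have "m \<in> portfolios M q" by (auto simp: portfolios_def exec) (simp add: m_def M_def)
  moreover have "m \<noteq> (\<lambda>_. 0)" using exec q by (auto simp: executions_def)
  ultimately have "h_lift \<Lambda> x \<le> OPT \<psi> 0 q q a c M"
    using net_value_le_OPT[of M m q \<psi> 0 q a c] q
    by (simp add: net_value_def J_acc_def exec corr \<psi>_def xpq)
  moreover have "OPT \<psi> 0 q q a c M \<le> h_lift \<Lambda> x"
    using OPT_no_cost_le[OF pool env assms lift] by (simp add: best)
  ultimately have "OPT \<psi> 0 q q a c M = h_lift \<Lambda> x" by simp
  moreover have "odds_lift_at_most q \<psi> \<Lambda>"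
    using env lift by (auto simp: odds_lift_at_most_def)
  ultimately show "\<exists>n K (M :: nat set) a c \<psi>.
        1 \<le> K \<and> evaluated_pool n a c M \<and>
        recovery_curves K \<psi> \<and> odds_lift_at_most K \<psi> \<Lambda> \<and>
        best_accuracy n a M = x \<and> OPT \<psi> 0 K n a c M = h_lift \<Lambda> x"
    using pool curves best q by (intro exI[of _ q] exI[of _ M] exI[of _ a] exI[of _ c] exI[of _ \<psi>]) auto
qed

theorem theorem1:
  fixes n K :: nat
    and a :: "nat \<Rightarrow> 'w \<Rightarrow> nat"
    and c :: "'w \<Rightarrow> real"
    and M :: "'w set"
    and \<psi> :: "nat \<Rightarrow> nat \<Rightarrow> real"
    and H :: "real \<Rightarrow> real"
    and \<gamma> \<Lambda> :: real
  assumes "evaluated_pool n a c M"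
    and "0 \<le> \<gamma>"
    and "1 \<le> K"
    and "recovery_curves K \<psi>"
    and "recovery_envelope K \<psi> H"
    and "1 \<le> \<Lambda>"
    and "odds_lift H \<le> ereal \<Lambda>"
  shows "V1 \<gamma> n a c M \<le> OPT \<psi> \<gamma> K n a c M \<and>
         OPT \<psi> \<gamma> K n a c M \<le> U_bound \<Lambda> \<gamma> K n a c M \<and>
         best_accuracy n a M \<le> OPT \<psi> 0 K n a c M \<and>
         OPT \<psi> 0 K n a c M \<le> h_lift \<Lambda> (best_accuracy n a M) \<and>
         no_cost_bound_tight \<Lambda>"
proof (intro conjI)
  show "V1 \<gamma> n a c M \<le> OPT \<psi> \<gamma> K n a c M"
    using V1_le_OPT assms by blast
  show "OPT \<psi> \<gamma> K n a c M \<le> U_bound \<Lambda> \<gamma> K n a c M"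
    using OPT_le_U_bound assms by blast
  have "best_accuracy n a M \<le> V1 0 n a c M"
    by (simp add: best_accuracy_def V1_def)
  also have "\<dots> \<le> OPT \<psi> 0 K n a c M"
    using V1_le_OPT assms by blast
  finally show "best_accuracy n a M \<le> OPT \<psi> 0 K n a c M" .
  show "OPT \<psi> 0 K n a c M \<le> h_lift \<Lambda> (best_accuracy n a M)"
    using OPT_no_cost_le assms by blast
  show "no_cost_bound_tight \<Lambda>"
    using no_cost_bound_tight assms by blast
qed

end
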